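(* Let $\kappa$ be a regular infinite cardinal and $\mu$ a singular cardinal with $\mathrm{cf}(\mu)=\kappa$. The spaces $({}^{\mu}2,\kappa)$ and $({}^{\mu}\kappa,\kappa)$ are homeomorphic if and only if $\kappa$ is not weakly compact.
   Context: For ordinals $\delta,\rho$, ${}^{\delta}\rho$ is the set of functions $\delta\to\rho$; for a partial function $s\colon\delta\rightharpoonup\rho$, $[s]=\{f\in{}^{\delta}\rho: s\subseteq f\}$. The ${<}\kappa$-box topology on ${}^{\delta}\rho$ has base $\{[s]: |\mathrm{dom}(s)|<\kappa\}$; $(X,\kappa)$ denotes $X$ with this topology. A space is ${<}\kappa$-compact if every open cover has a subcover of cardinality $<\kappa$. An infinite cardinal $\kappa$ is called weakly compact if $({}^{\kappa}2,\kappa)$ is ${<}\kappa$-compact (in particular $\aleph_0$ counts as weakly compact). *)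

theory Defs
  imports "HOL-Analysis.Analysis" "HOL-Library.FuncSet"
begin

text \<open>Cardinals are represented by cardinal well-orders (BNF library: Card_order),
  i.e. initial ordinals on their field.\<close>

definition cf_is :: "'m rel \<Rightarrow> 'k rel \<Rightarrow> bool" where
  "cf_is m k \<longleftrightarrow>
     (\<exists>K. K \<subseteq> Field m \<and> cofinal K m \<and> (card_of K, k) \<in> ordIso) \<and>
     (\<forall>K. K \<subseteq> Field m \<and> cofinal K m \<longrightarrow> (k, card_of K) \<in> ordLeq)"

definition singular_card :: "'m rel \<Rightarrow> bool" where
  "singular_card m \<longleftrightarrow> Card_order m \<and> infinite (Field m) \<and>
     (\<exists>K. K \<subseteq> Field m \<and> cofinal K m \<and> (card_of K, m) \<in> ordLess)"

definition box_topology :: "'d set \<Rightarrow> 'r set \<Rightarrow> 'k rel \<Rightarrow> ('d \<Rightarrow> 'r) topology" where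
  "box_topology D R k = topology_generated_by
     { {f \<in> D \<rightarrow>\<^sub>E R. \<forall>x\<in>dom s. s x = Some (f x)} | s.
         dom s \<subseteq> D \<and> ran s \<subseteq> R \<and> (card_of (dom s), k) \<in> ordLess }"

definition less_compact :: "'a topology \<Rightarrow> 'k rel \<Rightarrow> bool" where
  "less_compact X k \<longleftrightarrow>
     (\<forall>U. (\<forall>u\<in>U. openin X u) \<and> topspace X \<subseteq> \<Union>U \<longrightarrow>
        (\<exists>V\<subseteq>U. (card_of V, k) \<in> ordLess \<and> topspace X \<subseteq> \<Union>V))"

text \<open>Weakly compact (aleph_0 included): ({}^k 2, k) is <k-compact.\<close>
definition weakly_compact :: "'k rel \<Rightarrow> bool" where
  "weakly_compact k \<longleftrightarrow> Card_order k \<and> infinite (Field k) \<and>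
     less_compact (box_topology (Field k) (UNIV :: bool set) k) k"

end

theory Submission
  imports Defs
begin

text \<open>Write \<open>X\<close> for the space \<open>2\<^sup>k\<close>. If \<open>X\<close> is not \<open><k\<close>-compact, take an open cover without a small
  subcover and split \<open>X\<close> into the maximal basic sets \<open>[f restricted to an initial segment]\<close> lying
  inside a member of the cover. There are at least \<open>k\<close> of these, and each is a copy of \<open>X\<close>, so \<open>X\<close> is
  homeomorphic to \<open>Q \<times> X\<close> with \<open>Q\<close> discrete of size at least \<open>k\<close>, hence also to \<open>k \<times> X\<close>. Taking box
  powers, \<open>2\<^sup>m \<cong> X\<^sup>m \<cong> (k \<times> X)\<^sup>m \<cong> (k \<times> 2)\<^sup>m \<cong> k\<^sup>m\<close>.

  Conversely, if \<open>X\<close> is \<open><k\<close>-compact, then \<open>k\<close> is a strong limit, and a closing-off argument shows that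
  a continuous map from \<open>2\<^sup>m\<close> to a discrete space depends on at most \<open>k\<close> coordinates. Such a map thus
  factors through a continuous map on \<open>X\<close> and takes fewer than \<open>k\<close> values, whereas a coordinate of
  \<open>k\<^sup>m\<close> takes \<open>k\<close> values.\<close>

unbundle cardinal_syntax

section \<open>Sets of size below a regular cardinal\<close>

locale regular_cardinal =
  fixes k :: "'k rel"
  assumes card_order: "Card_order k"
    and infinite_Field: "infinite (Field k)"
    and regular: "regularCard k"
begin

lemma Cinfinite: "Cinfinite k"
  using card_order infinite_Field by (simp add: cinfinite_def)

lemma wo_rel: "wo_rel k"
  using card_order by (simp add: card_order_on_well_order_on wo_rel_def)

lemma card_of_Field: "|Field k| =o k"
  using card_order by (rule card_of_Field_ordIso)

lemma small_finite: "finite A \<Longrightarrow> |A| <o k"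
  using Cfinite_ordLess_Cinfinite[of "|A|", OF _ Cinfinite]
  by (simp add: cfinite_def Field_card_of card_of_card_order_on)

lemma small_subset: "A \<subseteq> B \<Longrightarrow> |B| <o k \<Longrightarrow> |A| <o k"
  using card_of_mono1 ordLeq_ordLess_trans by blast

lemma small_image: "|A| <o k \<Longrightarrow> |f ` A| <o k"
  using card_of_image ordLeq_ordLess_trans by blast

lemma small_UN: "|I| <o k \<Longrightarrow> (\<And>i. i \<in> I \<Longrightarrow> |A i| <o k) \<Longrightarrow> |\<Union>i\<in>I. A i| <o k"
  using regularCard_UNION_bound Cinfinite regular by blast

lemma small_Un: "|A| <o k \<Longrightarrow> |B| <o k \<Longrightarrow> |A \<union> B| <o k"
  using card_of_Un_ordLess_infinite_Field infinite_Field card_order by blast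

lemma small_insert: "|A| <o k \<Longrightarrow> |insert x A| <o k"
  using small_Un[OF small_finite[of "{x}"]] by simp

lemma not_small_iff: "\<not> |A| <o k \<longleftrightarrow> k \<le>o |A|"
  using card_order card_of_Well_order[of A] card_order_on_well_order_on not_ordLess_iff_ordLeq by blast

lemma small_under: "a \<in> Field k \<Longrightarrow> |under k a| <o k"
  using small_subset[OF _ small_insert[OF card_of_underS[OF card_order]], of "under k a" a a]
  by (force simp: under_def underS_def)

text \<open>Regularity forces every cofinal set to have size \<open>k\<close>, so a small set is not
  cofinal, and linearity turns this into an upper bound. Small sets of coordinates can thus be
  enlarged to initial segments, which are again small.\<close>

lemma small_bounded:
  assumes "A \<subseteq> Field k" "|A| <o k"
  obtains a where "a \<in> Field k" "A \<subseteq> under k a"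
proof -
  have "\<not> cofinal A k"
    using regular assms not_ordLess_ordIso unfolding regularCard_def by blast
  then obtain a where "a \<in> Field k" "\<forall>b\<in>A. a = b \<or> (a, b) \<notin> k"
    unfolding cofinal_def by blast
  moreover have "(b, a) \<in> k" if "b \<in> A" for b
    using that assms(1) calculation wo_rel.in_notinI[OF wo_rel, of a b] by fast
  ultimately show thesis
    using that unfolding under_def by blast
qed

section \<open>Open sets and continuous maps of box topologies\<close>

lemma topspace_box [simp]: "topspace (box_topology D R k) = (D \<rightarrow>\<^sub>E R)"
proof -
  let ?B = "\<lambda>s. {f \<in> D \<rightarrow>\<^sub>E R. \<forall>x\<in>dom s. s x = Some (f x)}"
  \<comment> \<open>The empty partial function is a legal condition, and its basic set is the whole
    function space; hence the generating family already covers all points.\<close>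
  have "?B Map.empty \<in> {?B s | s. dom s \<subseteq> D \<and> ran s \<subseteq> R \<and> |dom s| <o k}"
    using small_finite[of "{}"] by (intro CollectI exI[of _ Map.empty]) simp
  moreover have "?B Map.empty = (D \<rightarrow>\<^sub>E R)"
    by simp
  ultimately show ?thesis
    unfolding box_topology_def topology_generated_by_topspace by blast
qed

text \<open>The local condition survives finite intersections because two small supports have a
  small union, and it survives arbitrary unions trivially. Later arguments reason with small
  supports \<open>A\<close> instead of the generated topology.\<close>

lemma openin_box_iff:
  "openin (box_topology D R k) U \<longleftrightarrow> U \<subseteq> D \<rightarrow>\<^sub>E R \<and>
     (\<forall>f\<in>U. \<exists>A\<subseteq>D. |A| <o k \<and> (\<forall>g\<in>D \<rightarrow>\<^sub>E R. (\<forall>d\<in>A. g d = f d) \<longrightarrow> g \<in> U))"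
  (is "_ \<longleftrightarrow> _ \<and> ?loc U")
proof
  assume U: "openin (box_topology D R k) U"
  define \<B> where "\<B> = {{f \<in> D \<rightarrow>\<^sub>E R. \<forall>x\<in>dom s. s x = Some (f x)} | s.
    dom s \<subseteq> D \<and> ran s \<subseteq> R \<and> |dom s| <o k}"
  have "generate_topology_on \<B> U"
    using U unfolding \<B>_def box_topology_def openin_topology_generated_by_iff .
  then have "?loc U"
  proof (induction rule: generate_topology_on.induct)
    case (Int a b)
    show ?case
    proof
      fix f assume "f \<in> a \<inter> b"
      then have f: "f \<in> a" "f \<in> b"
        by auto
      obtain A where "A \<subseteq> D" "|A| <o k" "\<forall>g\<in>D \<rightarrow>\<^sub>E R. (\<forall>d\<in>A. g d = f d) \<longrightarrow> g \<in> a"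
        using bspec[OF Int.IH(1) f(1)] by (elim exE conjE)
      moreover obtain B where "B \<subseteq> D" "|B| <o k" "\<forall>g\<in>D \<rightarrow>\<^sub>E R. (\<forall>d\<in>B. g d = f d) \<longrightarrow> g \<in> b"
        using bspec[OF Int.IH(2) f(2)] by (elim exE conjE)
      ultimately show "\<exists>A\<subseteq>D. |A| <o k \<and> (\<forall>g\<in>D \<rightarrow>\<^sub>E R. (\<forall>d\<in>A. g d = f d) \<longrightarrow> g \<in> a \<inter> b)"
        by (intro exI[of _ "A \<union> B"]) (simp add: small_Un)
    qed
  next
    case (UN K)
    show ?case
    proof
      fix f assume "f \<in> \<Union>K"
      then obtain V where V: "V \<in> K" "f \<in> V"
        by blast
      obtain A where "A \<subseteq> D" "|A| <o k" "\<forall>g\<in>D \<rightarrow>\<^sub>E R. (\<forall>d\<in>A. g d = f d) \<longrightarrow> g \<in> V"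
        using bspec[OF UN.IH[OF V(1)] V(2)] by (elim exE conjE)
      then show "\<exists>A\<subseteq>D. |A| <o k \<and> (\<forall>g\<in>D \<rightarrow>\<^sub>E R. (\<forall>d\<in>A. g d = f d) \<longrightarrow> g \<in> \<Union>K)"
        using V(1) by (intro exI[of _ A]) auto
    qed
  next
    case (Basis V)
    then obtain s where s: "V = {f \<in> D \<rightarrow>\<^sub>E R. \<forall>x\<in>dom s. s x = Some (f x)}" "dom s \<subseteq> D" "|dom s| <o k"
      unfolding \<B>_def by blast
    then show ?case
      by (intro ballI exI[of _ "dom s"]) simp
  qed simp
  then show "U \<subseteq> D \<rightarrow>\<^sub>E R \<and> ?loc U"
    using openin_subset[OF U] by simp
next
  assume U: "U \<subseteq> D \<rightarrow>\<^sub>E R \<and> ?loc U"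
  show "openin (box_topology D R k) U"
  proof (subst openin_subopen, intro ballI)
    fix f assume f: "f \<in> U"
    then obtain A where A: "A \<subseteq> D" "|A| <o k" "\<forall>g\<in>D \<rightarrow>\<^sub>E R. (\<forall>d\<in>A. g d = f d) \<longrightarrow> g \<in> U"
      using bspec[OF conjunct2[OF U] f] by (elim exE conjE)
    \<comment> \<open>The partial function with domain \<open>A\<close> that follows
      \<open>f\<close>; its basic set is the neighbourhood of \<open>f\<close> inside
      \<open>U\<close>.\<close>
    define s where "s = (\<lambda>d. if d \<in> A then Some (f d) else None)"
    define T where "T = {g \<in> D \<rightarrow>\<^sub>E R. \<forall>x\<in>dom s. s x = Some (g x)}"
    have dom: "dom s = A"
      by (auto simp: s_def dom_def)
    have "ran s \<subseteq> R"
      using f U A(1) by (fastforce simp: s_def ran_def split: if_splits)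
    then have "openin (box_topology D R k) T"
      unfolding box_topology_def openin_topology_generated_by_iff
      using A dom by (intro generate_topology_on.Basis) (auto simp: T_def)
    moreover have "f \<in> T"
      using f U by (auto simp: T_def dom) (auto simp: s_def)
    moreover have "T \<subseteq> U"
      using A(3) unfolding T_def dom by (auto simp: s_def)
    ultimately show "\<exists>T. openin (box_topology D R k) T \<and> f \<in> T \<and> T \<subseteq> U"
      by blast
  qed
qed

text \<open>Continuity into a discrete space is local constancy, and the neighbourhoods of
  \<open>f\<close> are given by small supports.\<close>

lemma continuous_map_box_discrete_iff:
  "continuous_map (box_topology D R k) (discrete_topology I) c \<longleftrightarrow>
     c \<in> (D \<rightarrow>\<^sub>E R) \<rightarrow> I \<and>
     (\<forall>f\<in>D \<rightarrow>\<^sub>E R. \<exists>A\<subseteq>D. |A| <o k \<and> (\<forall>g\<in>D \<rightarrow>\<^sub>E R. (\<forall>d\<in>A. g d = f d) \<longrightarrow> c g = c f))"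
  (is "_ \<longleftrightarrow> _ \<and> ?loc")
proof
  assume c: "continuous_map (box_topology D R k) (discrete_topology I) c"
  then have "c \<in> (D \<rightarrow>\<^sub>E R) \<rightarrow> I"
    by (auto simp: continuous_map_def)
  moreover have ?loc
  proof
    fix f assume f: "f \<in> D \<rightarrow>\<^sub>E R"
    have "openin (discrete_topology I) {c f}"
      using f calculation by auto
    from openin_continuous_map_preimage[OF c this]
    have "openin (box_topology D R k) {g \<in> D \<rightarrow>\<^sub>E R. c g \<in> {c f}}"
      unfolding topspace_box .
    then show "\<exists>A\<subseteq>D. |A| <o k \<and> (\<forall>g\<in>D \<rightarrow>\<^sub>E R. (\<forall>d\<in>A. g d = f d) \<longrightarrow> c g = c f)"
      using f unfolding openin_box_iff by fastforce
  qed
  ultimately show "c \<in> (D \<rightarrow>\<^sub>E R) \<rightarrow> I \<and> ?loc" ..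
next
  assume *: "c \<in> (D \<rightarrow>\<^sub>E R) \<rightarrow> I \<and> ?loc"
  have "openin (box_topology D R k) {g \<in> D \<rightarrow>\<^sub>E R. c g \<in> U}" for U
    unfolding openin_box_iff
  proof (intro conjI ballI)
    fix f assume "f \<in> {g \<in> D \<rightarrow>\<^sub>E R. c g \<in> U}"
    then have f: "f \<in> D \<rightarrow>\<^sub>E R" "c f \<in> U"
      by auto
    obtain A where A: "A \<subseteq> D" "|A| <o k" "\<forall>g\<in>D \<rightarrow>\<^sub>E R. (\<forall>d\<in>A. g d = f d) \<longrightarrow> c g = c f"
      using bspec[OF conjunct2[OF *] f(1)] by (elim exE conjE)
    have "c g \<in> U" if "g \<in> D \<rightarrow>\<^sub>E R" "\<forall>d\<in>A. g d = f d" for g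
      using A(3)[rule_format, of g] that f(2) by simp
    then show "\<exists>A\<subseteq>D. |A| <o k \<and>
        (\<forall>g\<in>D \<rightarrow>\<^sub>E R. (\<forall>d\<in>A. g d = f d) \<longrightarrow> g \<in> {g \<in> D \<rightarrow>\<^sub>E R. c g \<in> U})"
      using A(1,2) by (intro exI[of _ A]) simp
  qed auto
  then show "continuous_map (box_topology D R k) (discrete_topology I) c"
    using * by (simp add: continuous_map_def)
qed

text \<open>Although a basic set of the target may restrict infinitely many coordinates, continuity
  can be checked one coordinate at a time: fewer than \<open>k\<close> coordinates are restricted,
  and by regularity the union of their small supports is small.\<close>

lemma continuous_map_box_iff:
  "continuous_map (box_topology D R k) (box_topology E T k) F \<longleftrightarrow>
     F \<in> (D \<rightarrow>\<^sub>E R) \<rightarrow> (E \<rightarrow>\<^sub>E T) \<and>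
     (\<forall>f\<in>D \<rightarrow>\<^sub>E R. \<forall>e\<in>E. \<exists>A\<subseteq>D. |A| <o k \<and> (\<forall>g\<in>D \<rightarrow>\<^sub>E R. (\<forall>d\<in>A. g d = f d) \<longrightarrow> F g e = F f e))"
  (is "_ \<longleftrightarrow> _ \<and> ?loc")
proof
  assume F: "continuous_map (box_topology D R k) (box_topology E T k) F"
  then have "F \<in> (D \<rightarrow>\<^sub>E R) \<rightarrow> (E \<rightarrow>\<^sub>E T)"
    by (auto simp: continuous_map_def)
  moreover have ?loc
  proof (intro ballI)
    fix f e assume f: "f \<in> D \<rightarrow>\<^sub>E R" and e: "e \<in> E"
    have "continuous_map (box_topology E T k) (discrete_topology T) (\<lambda>h. h e)"
      unfolding continuous_map_box_discrete_iff
      using e small_finite[of "{e}"] by (auto intro!: exI[of _ "{e}"])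
    then have "continuous_map (box_topology D R k) (discrete_topology T) ((\<lambda>h. h e) \<circ> F)"
      using F continuous_map_compose by blast
    then show "\<exists>A\<subseteq>D. |A| <o k \<and> (\<forall>g\<in>D \<rightarrow>\<^sub>E R. (\<forall>d\<in>A. g d = f d) \<longrightarrow> F g e = F f e)"
      using f unfolding continuous_map_box_discrete_iff o_def by blast
  qed
  ultimately show "F \<in> (D \<rightarrow>\<^sub>E R) \<rightarrow> (E \<rightarrow>\<^sub>E T) \<and> ?loc" ..
next
  assume *: "F \<in> (D \<rightarrow>\<^sub>E R) \<rightarrow> (E \<rightarrow>\<^sub>E T) \<and> ?loc"
  have "openin (box_topology D R k) {g \<in> D \<rightarrow>\<^sub>E R. F g \<in> U}" if U: "openin (box_topology E T k) U" for U
    unfolding openin_box_iff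
  proof (intro conjI ballI)
    fix f assume "f \<in> {g \<in> D \<rightarrow>\<^sub>E R. F g \<in> U}"
    then have f: "f \<in> D \<rightarrow>\<^sub>E R" "F f \<in> U"
      by auto
    obtain B where B: "B \<subseteq> E" "|B| <o k" "\<forall>h\<in>E \<rightarrow>\<^sub>E T. (\<forall>e\<in>B. h e = F f e) \<longrightarrow> h \<in> U"
      using bspec[OF conjunct2[OF U[unfolded openin_box_iff]] f(2)] by (elim exE conjE)
    obtain A where A: "\<And>e. e \<in> E \<Longrightarrow> A e \<subseteq> D" "\<And>e. e \<in> E \<Longrightarrow> |A e| <o k"
      "\<And>e g. e \<in> E \<Longrightarrow> g \<in> D \<rightarrow>\<^sub>E R \<Longrightarrow> (\<forall>d\<in>A e. g d = f d) \<Longrightarrow> F g e = F f e"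
      using conjunct2[OF *, rule_format, OF f(1)] by metis
    have "|\<Union>e\<in>B. A e| <o k"
      using small_UN[OF B(2)] A(2) B(1) by blast
    moreover have "F g \<in> U" if "g \<in> D \<rightarrow>\<^sub>E R" "\<forall>d\<in>\<Union>e\<in>B. A e. g d = f d" for g
    proof -
      have "\<forall>e\<in>B. F g e = F f e"
        using A(3) B(1) that by blast
      moreover have "F g \<in> E \<rightarrow>\<^sub>E T"
        using * that(1) by blast
      ultimately show ?thesis
        using B(3) by blast
    qed
    moreover have "(\<Union>e\<in>B. A e) \<subseteq> D"
      using A(1) B(1) by blast
    ultimately show "\<exists>A\<subseteq>D. |A| <o k \<and> (\<forall>g\<in>D \<rightarrow>\<^sub>E R. (\<forall>d\<in>A. g d = f d) \<longrightarrow> g \<in> {g \<in> D \<rightarrow>\<^sub>E R. F g \<in> U})"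
      by (intro exI[of _ "\<Union>e\<in>B. A e"]) auto
  qed auto
  then show "continuous_map (box_topology D R k) (box_topology E T k) F"
    using * by (simp add: continuous_map_def)
qed

section \<open>Renaming coordinates and values\<close>

lemma box_reindex_domain:
  assumes "bij_betw e D E"
  shows "box_topology E R k homeomorphic_space box_topology D R k"
proof -
  define e' where "e' = the_inv_into D e"
  have e: "e d \<in> E" "e' (e d) = d" if "d \<in> D" for d
    using assms that by (auto simp: e'_def bij_betw_def the_inv_into_f_f)
  have e': "e' x \<in> D" "e (e' x) = x" if "x \<in> E" for x
    using assms that the_inv_into_into[of e D x D] f_the_inv_into_f[of e D x] by (auto simp: e'_def bij_betw_def)
  have "homeomorphic_maps (box_topology E R k) (box_topology D R k)
      (\<lambda>f. \<lambda>d\<in>D. f (e d)) (\<lambda>g. \<lambda>x\<in>E. g (e' x))"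
    unfolding homeomorphic_maps_def continuous_map_box_iff
  proof (intro conjI ballI)
    fix f :: "'b \<Rightarrow> 'c" and d assume "d \<in> D"
    then show "\<exists>A\<subseteq>E. |A| <o k \<and> (\<forall>g\<in>E \<rightarrow>\<^sub>E R. (\<forall>d\<in>A. g d = f d) \<longrightarrow>
        (\<lambda>d\<in>D. g (e d)) d = (\<lambda>d\<in>D. f (e d)) d)"
      using e small_finite[of "{e d}"] by (intro exI[of _ "{e d}"]) auto
  next
    fix f :: "'a \<Rightarrow> 'c" and x assume "x \<in> E"
    then show "\<exists>A\<subseteq>D. |A| <o k \<and> (\<forall>g\<in>D \<rightarrow>\<^sub>E R. (\<forall>d\<in>A. g d = f d) \<longrightarrow>
        (\<lambda>x\<in>E. g (e' x)) x = (\<lambda>x\<in>E. f (e' x)) x)"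
      using e' small_finite[of "{e' x}"] by (intro exI[of _ "{e' x}"]) auto
  qed (auto simp: e e' PiE_iff extensional_def fun_eq_iff)
  then show ?thesis
    unfolding homeomorphic_space_def by blast
qed

lemma box_reindex_range:
  assumes "bij_betw e R T"
  shows "box_topology D R k homeomorphic_space box_topology D T k"
proof -
  define e' where "e' = the_inv_into R e"
  have e: "e d \<in> T" "e' (e d) = d" if "d \<in> R" for d
    using assms that by (auto simp: e'_def bij_betw_def the_inv_into_f_f)
  have e': "e' x \<in> R" "e (e' x) = x" if "x \<in> T" for x
    using assms that the_inv_into_into[of e R x R] f_the_inv_into_f[of e R x] by (auto simp: e'_def bij_betw_def)
  have "homeomorphic_maps (box_topology D R k) (box_topology D T k)
      (\<lambda>f. \<lambda>d\<in>D. e (f d)) (\<lambda>g. \<lambda>d\<in>D. e' (g d))"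
    unfolding homeomorphic_maps_def continuous_map_box_iff
  proof (intro conjI ballI)
    fix f :: "'c \<Rightarrow> 'a" and d assume "d \<in> D"
    then show "\<exists>A\<subseteq>D. |A| <o k \<and> (\<forall>g\<in>D \<rightarrow>\<^sub>E R. (\<forall>d\<in>A. g d = f d) \<longrightarrow>
        (\<lambda>d\<in>D. e (g d)) d = (\<lambda>d\<in>D. e (f d)) d)"
      using small_finite[of "{d}"] by (intro exI[of _ "{d}"]) auto
  next
    fix f :: "'c \<Rightarrow> 'b" and d assume "d \<in> D"
    then show "\<exists>A\<subseteq>D. |A| <o k \<and> (\<forall>g\<in>D \<rightarrow>\<^sub>E T. (\<forall>d\<in>A. g d = f d) \<longrightarrow>
        (\<lambda>d\<in>D. e' (g d)) d = (\<lambda>d\<in>D. e' (f d)) d)"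
      using small_finite[of "{d}"] by (intro exI[of _ "{d}"]) auto
  qed (auto simp: e e' PiE_iff extensional_def fun_eq_iff)
  then show ?thesis
    unfolding homeomorphic_space_def by blast
qed

end

section \<open>Products with a discrete factor\<close>

lemma continuous_map_prod_discrete_left:
  assumes "\<And>q. q \<in> Q \<Longrightarrow> continuous_map Y Z (\<lambda>y. f (q, y))"
  shows "continuous_map (prod_topology (discrete_topology Q) Y) Z f"
  unfolding continuous_map_def
proof (intro conjI allI impI)
  show "f \<in> topspace (prod_topology (discrete_topology Q) Y) \<rightarrow> topspace Z"
    using assms by (auto simp: continuous_map_def)
next
  fix U assume U: "openin Z U"
  \<comment> \<open>A preimage is the union of its slices over the points of \<open>Q\<close>; each
    slice is open because singletons are open in the discrete factor.\<close>
  have "{p \<in> topspace (prod_topology (discrete_topology Q) Y). f p \<in> U} =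
      (\<Union>q\<in>Q. {q} \<times> {y \<in> topspace Y. f (q, y) \<in> U})"
    by auto
  moreover have "openin Y {y \<in> topspace Y. f (q, y) \<in> U}" if "q \<in> Q" for q
    using openin_continuous_map_preimage[OF assms[OF that] U] .
  ultimately show "openin (prod_topology (discrete_topology Q) Y)
      {p \<in> topspace (prod_topology (discrete_topology Q) Y). f p \<in> U}"
    by (auto simp: openin_prod_Times_iff)
qed

lemma homeomorphic_space_prod_topology_assoc:
  "prod_topology (prod_topology X Y) Z homeomorphic_space prod_topology X (prod_topology Y Z)"
proof -
  have "homeomorphic_maps (prod_topology (prod_topology X Y) Z) (prod_topology X (prod_topology Y Z))
      (\<lambda>p. (fst (fst p), snd (fst p), snd p)) (\<lambda>p. ((fst p, fst (snd p)), snd (snd p)))"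
    unfolding homeomorphic_maps_def
    by (auto simp: continuous_map_pairwise o_def intro: continuous_map_fst_of[unfolded o_def]
        continuous_map_snd_of[unfolded o_def] continuous_map_fst continuous_map_snd)
  then show ?thesis
    unfolding homeomorphic_space_def by blast
qed

lemma homeomorphic_space_discrete_topology:
  assumes "bij_betw e S T"
  shows "discrete_topology S homeomorphic_space discrete_topology T"
proof -
  have "homeomorphic_maps (discrete_topology S) (discrete_topology T) e (the_inv_into S e)"
    using assms the_inv_into_into[of e S _ S]
    by (auto simp: homeomorphic_maps_def bij_betw_def the_inv_into_f_f f_the_inv_into_f)
  then show ?thesis
    unfolding homeomorphic_space_def by blast
qed

text \<open>Since \<open>Q\<close> and \<open>K \<times> Q\<close> are equinumerous, a factor
  \<open>K\<close> can be split off from \<open>Q\<close>, and the remaining factor \<open>Q\<close>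
  is swallowed by \<open>Y\<close> again.\<close>

lemma discrete_factor_absorb:
  assumes Y: "Y homeomorphic_space prod_topology (discrete_topology Q) Y"
    and e: "bij_betw e Q (K \<times> Q)"
  shows "Y homeomorphic_space prod_topology (discrete_topology K) Y"
proof -
  note Y
  also have "prod_topology (discrete_topology Q) Y homeomorphic_space
      prod_topology (prod_topology (discrete_topology K) (discrete_topology Q)) Y"
    unfolding prod_topology_discrete_topology[symmetric]
    by (intro homeomorphic_space_prod_topology homeomorphic_space_discrete_topology[OF e] homeomorphic_space_refl)
  also have "prod_topology (prod_topology (discrete_topology K) (discrete_topology Q)) Y homeomorphic_space
      prod_topology (discrete_topology K) (prod_topology (discrete_topology Q) Y)"
    by (rule homeomorphic_space_prod_topology_assoc)
  also have "prod_topology (discrete_topology K) (prod_topology (discrete_topology Q) Y) homeomorphic_space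
      prod_topology (discrete_topology K) Y"
    by (intro homeomorphic_space_prod_topology homeomorphic_space_refl homeomorphic_space_sym[THEN iffD1, OF Y])
  finally show ?thesis .
qed

section \<open>The non-compact case: absorbing a discrete factor\<close>

context regular_cardinal
begin

text \<open>The segment is small, so its complement cannot be small as well. The bijection renumbers
  the coordinates left free by a condition on an initial segment, which makes the basic set of that
  condition a copy of the whole space.\<close>

lemma bij_betw_Diff_under:
  assumes "a \<in> Field k"
  shows "\<exists>e. bij_betw e (Field k) (Field k - under k a)"
proof -
  have "\<not> |Field k - under k a| <o k"
  proof
    assume "|Field k - under k a| <o k"
    then have "|(Field k - under k a) \<union> under k a| <o k"
      using small_Un small_under assms by blast
    then have "|Field k| <o k"
      by (rule small_subset[rotated]) auto
    then show False
      using card_of_Field not_ordLess_ordIso by blast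
  qed
  then have "|Field k| \<le>o |Field k - under k a|"
    using not_small_iff card_of_Field ordIso_ordLeq_trans by blast
  moreover have "|Field k - under k a| \<le>o |Field k|"
    by (rule card_of_mono1) auto
  ultimately show ?thesis
    using card_of_ordIso ordIso_iff_ordLeq by blast
qed

text \<open>The index set \<open>Q\<close> consists of the blocks of a partition that refines an
  open cover without a small subcover. Sending a point to its block is locally constant, and within
  a block the free coordinates can be renumbered by all of \<open>k\<close>.\<close>

lemma not_less_compact_box_discrete_factor:
  fixes R :: "'r set"
  assumes "\<not> less_compact (box_topology (Field k) R k) k"
  obtains Q :: "('k \<times> ('k \<Rightarrow> 'r)) set" where "k \<le>o |Q|"
    "box_topology (Field k) R k homeomorphic_space
       prod_topology (discrete_topology Q) (box_topology (Field k) R k)"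
proof -
  define X where "X = (Field k \<rightarrow>\<^sub>E R)"
  obtain \<U> where opn: "\<forall>u\<in>\<U>. openin (box_topology (Field k) R k) u"
    and cover: "X \<subseteq> \<Union>\<U>"
    and "\<not> (\<exists>\<V>\<subseteq>\<U>. |\<V>| <o k \<and> X \<subseteq> \<Union>\<V>)"
    using assms unfolding less_compact_def topspace_box X_def not_all not_imp by (elim exE conjE)
  then have no_sub: "\<And>\<V>. \<V> \<subseteq> \<U> \<Longrightarrow> |\<V>| <o k \<Longrightarrow> \<not> X \<subseteq> \<Union>\<V>"
    by blast
  have trans: "(a, c) \<in> k" if "(a, b) \<in> k" "(b, c) \<in> k" for a b c
    using that wo_rel.TRANS[OF wo_rel] unfolding trans_def by blast
  have under_Field: "under k a \<subseteq> Field k" for a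
    by (auto simp: under_def Field_def)
  define good where "good f b \<longleftrightarrow> (\<exists>u\<in>\<U>. \<forall>g\<in>X. (\<forall>d\<in>under k b. g d = f d) \<longrightarrow> g \<in> u)" for f b
  \<comment> \<open>The least initial segment that decides a member of the cover around \<open>f\<close>; the resulting
      basic sets partition the space.\<close>
  define lev where "lev f = wo_rel.minim k {b \<in> Field k. good f b}" for f
  have ex_good: "\<exists>b\<in>Field k. good f b" if f: "f \<in> X" for f
  proof -
    obtain u where u: "u \<in> \<U>" "f \<in> u"
      using cover f by blast
    then have "openin (box_topology (Field k) R k) u"
      using opn by blast
    from bspec[OF conjunct2[OF this[unfolded openin_box_iff]] u(2)]
    obtain A where A: "A \<subseteq> Field k" "|A| <o k" "\<forall>g\<in>X. (\<forall>d\<in>A. g d = f d) \<longrightarrow> g \<in> u"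
      unfolding X_def by (elim exE conjE)
    obtain a where a: "a \<in> Field k" "A \<subseteq> under k a"
      using small_bounded[OF A(1,2)] .
    have "g \<in> u" if "g \<in> X" "\<forall>d\<in>under k a. g d = f d" for g
      using A(3)[rule_format, OF that(1)] that(2) a(2) by (simp add: subset_iff)
    then have "good f a"
      unfolding good_def using u(1) by (intro bexI[of _ u]) simp_all
    then show ?thesis
      using a(1) by blast
  qed
  have lev: "lev f \<in> Field k" "good f (lev f)" if "f \<in> X" for f
    using wo_rel.minim_in[OF wo_rel, of "{b \<in> Field k. good f b}"] ex_good[OF that]
    unfolding lev_def by auto
  have lev_least: "(lev f, b) \<in> k" if "b \<in> Field k" "good f b" for f b
    using wo_rel.minim_least[OF wo_rel, of "{b \<in> Field k. good f b}" b] that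
    unfolding lev_def by auto
  have good_cong: "good g b" if good: "good f b" and eq: "\<forall>d\<in>under k b. g d = f d" for f g b
  proof -
    obtain u where u: "u \<in> \<U>" "\<forall>h\<in>X. (\<forall>d\<in>under k b. h d = f d) \<longrightarrow> h \<in> u"
      using good unfolding good_def by (elim bexE)
    then show ?thesis
      using eq unfolding good_def by (intro bexI[of _ u]) simp_all
  qed
  \<comment> \<open>The level depends only on the coordinates up to itself. Agreement up to
    \<open>lev f\<close> gives \<open>lev g \<le> lev f\<close>; then \<open>f\<close> and
    \<open>g\<close> agree up to \<open>lev g\<close> too, and the roles can be exchanged.\<close>
  have lev_cong: "lev g = lev f" if "f \<in> X" "g \<in> X" and eq: "\<forall>d\<in>under k (lev f). g d = f d" for f g
  proof -
    have "good g (lev f)"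
      using good_cong[OF lev(2)[OF \<open>f \<in> X\<close>] eq] .
    then have le: "(lev g, lev f) \<in> k"
      using lev_least[OF lev(1)[OF \<open>f \<in> X\<close>]] by blast
    have "\<forall>d\<in>under k (lev g). f d = g d"
      using eq trans[OF _ le] unfolding under_def by simp
    from good_cong[OF lev(2)[OF \<open>g \<in> X\<close>] this] have "good f (lev g)" .
    then have "(lev f, lev g) \<in> k"
      using lev_least[OF lev(1)[OF \<open>g \<in> X\<close>]] by blast
    with le show ?thesis
      using wo_rel.ANTISYM[OF wo_rel] unfolding antisym_def by blast
  qed
  \<comment> \<open>The level is stored along with the values, because \<open>restrict\<close> fills
    in \<open>undefined\<close>, which may itself be a value in \<open>R\<close>; the restricted
    function alone need not reveal its segment.\<close>
  define block where "block f = (lev f, restrict f (under k (lev f)))" for f :: "'k \<Rightarrow> 'r"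
  have block_cong: "block g = block f" if "f \<in> X" "g \<in> X" "\<forall>d\<in>under k (lev f). g d = f d" for f g
    using lev_cong[OF that] that(3) unfolding block_def by (auto intro: restrict_ext)
  define Q where "Q = block ` X"
  \<comment> \<open>Each block lies in some member of the cover, so fewer than \<open>k\<close>
    blocks would yield a small subcover by choosing one member per block.\<close>
  have "\<not> |Q| <o k"
  proof
    assume small: "|Q| <o k"
    have "\<exists>u\<in>\<U>. \<forall>f\<in>X. block f = q \<longrightarrow> f \<in> u" if q: "q \<in> Q" for q
    proof -
      obtain f where f: "f \<in> X" "q = block f"
        using q unfolding Q_def by blast
      obtain u where u: "u \<in> \<U>" "\<forall>g\<in>X. (\<forall>d\<in>under k (lev f). g d = f d) \<longrightarrow> g \<in> u"
        using lev(2)[OF f(1)] unfolding good_def by (elim bexE)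
      have "g \<in> u" if "g \<in> X" "block g = q" for g
      proof -
        have "lev g = lev f" "restrict g (under k (lev f)) = restrict f (under k (lev f))"
          using that(2) f(2) by (auto simp: block_def)
        then have "\<forall>d\<in>under k (lev f). g d = f d"
          by (metis restrict_apply')
        then show ?thesis
          using u(2) that(1) by blast
      qed
      then show ?thesis
        using u(1) by blast
    qed
    then obtain u where u: "\<And>q. q \<in> Q \<Longrightarrow> u q \<in> \<U>" "\<And>q f. q \<in> Q \<Longrightarrow> f \<in> X \<Longrightarrow> block f = q \<Longrightarrow> f \<in> u q"
      by metis
    have "X \<subseteq> \<Union>(u ` Q)"
      using u(2) unfolding Q_def by blast
    moreover have "u ` Q \<subseteq> \<U>"
      using u(1) by blast
    ultimately show False
      using no_sub small_image[OF small] by blast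
  qed
  then have "k \<le>o |Q|"
    using not_small_iff by blast
  obtain e where e_bij: "\<And>a. a \<in> Field k \<Longrightarrow> bij_betw (e a) (Field k) (Field k - under k a)"
    using bij_betw_Diff_under by metis
  define e' where "e' a = the_inv_into (Field k) (e a)" for a
  have e: "e a x \<in> Field k" "e a x \<notin> under k a" "e' a (e a x) = x" if "a \<in> Field k" "x \<in> Field k" for a x
    using e_bij[OF that(1)] that(2) by (auto simp: e'_def bij_betw_def the_inv_into_f_f)
  have e': "e' a x \<in> Field k" "e a (e' a x) = x" if "a \<in> Field k" "x \<in> Field k" "x \<notin> under k a" for a x
    using e_bij[OF that(1)] that(2,3) the_inv_into_into[of "e a" "Field k" x "Field k"]
      f_the_inv_into_f[of "e a" "Field k" x]
    by (auto simp: e'_def bij_betw_def)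
  \<comment> \<open>\<open>\<phi>\<close> splits a point into its block and its values beyond the
    level, renumbered by \<open>e\<close>; \<open>\<psi>\<close> pastes the two pieces together
    again.\<close>
  define \<phi> where "\<phi> f = (block f, \<lambda>x\<in>Field k. f (e (lev f) x))" for f
  define \<psi> where "\<psi> p = (\<lambda>x\<in>Field k. if x \<in> under k (fst (fst p)) then snd (fst p) x
      else snd p (e' (fst (fst p)) x))" for p :: "('k \<times> ('k \<Rightarrow> 'r)) \<times> ('k \<Rightarrow> 'r)"
  have \<psi>_block: "\<psi> (block f, g) = (\<lambda>x\<in>Field k. if x \<in> under k (lev f) then f x else g (e' (lev f) x))" for f g
    by (auto simp: \<psi>_def block_def fun_eq_iff)
  have \<psi>_in: "\<psi> (block f, g) \<in> X" if "f \<in> X" "g \<in> X" for f g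
    unfolding \<psi>_block X_def restrict_PiE_iff
    using PiE_mem[OF that(1)[unfolded X_def]] PiE_mem[OF that(2)[unfolded X_def]] e'(1)[OF lev(1)[OF that(1)]]
    by simp
  have "continuous_map (box_topology (Field k) R k) (discrete_topology Q) block"
    unfolding continuous_map_box_discrete_iff
  proof (intro conjI ballI)
    fix f assume f: "f \<in> Field k \<rightarrow>\<^sub>E R"
    show "\<exists>A\<subseteq>Field k. |A| <o k \<and> (\<forall>g\<in>Field k \<rightarrow>\<^sub>E R. (\<forall>d\<in>A. g d = f d) \<longrightarrow> block g = block f)"
      using small_under[OF lev(1)] under_Field block_cong f unfolding X_def[symmetric]
      by (intro exI[of _ "under k (lev f)"] conjI ballI impI)
  qed (auto simp: Q_def X_def)
  moreover have "continuous_map (box_topology (Field k) R k) (box_topology (Field k) R k)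
      (\<lambda>f. \<lambda>x\<in>Field k. f (e (lev f) x))"
    unfolding continuous_map_box_iff
  proof (intro conjI ballI)
    show "(\<lambda>f. \<lambda>x\<in>Field k. f (e (lev f) x)) \<in> (Field k \<rightarrow>\<^sub>E R) \<rightarrow> (Field k \<rightarrow>\<^sub>E R)"
      by (intro funcsetI restrict_PiE_iff[THEN iffD2] ballI PiE_mem[of _ "Field k" "\<lambda>_. R"] e(1) lev(1))
        (simp_all add: X_def)
  next
    fix f x assume f: "f \<in> Field k \<rightarrow>\<^sub>E R" and x: "x \<in> Field k"
    \<comment> \<open>The segment fixes the level and hence the renumbering in use; the additional
      coordinate supplies the value that is read.\<close>
    let ?A = "insert (e (lev f) x) (under k (lev f))"
    have "(\<lambda>x\<in>Field k. g (e (lev g) x)) x = (\<lambda>x\<in>Field k. f (e (lev f) x)) x"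
      if "g \<in> Field k \<rightarrow>\<^sub>E R" "\<forall>d\<in>?A. g d = f d" for g
      using lev_cong[of f g] f that x by (simp add: X_def)
    moreover have "?A \<subseteq> Field k" "|?A| <o k"
      using f x e(1) lev(1) small_insert[OF small_under] under_Field by (auto simp: X_def)
    ultimately show "\<exists>A\<subseteq>Field k. |A| <o k \<and> (\<forall>g\<in>Field k \<rightarrow>\<^sub>E R. (\<forall>d\<in>A. g d = f d) \<longrightarrow>
        (\<lambda>x\<in>Field k. g (e (lev g) x)) x = (\<lambda>x\<in>Field k. f (e (lev f) x)) x)"
      by blast
  qed
  ultimately have "continuous_map (box_topology (Field k) R k)
      (prod_topology (discrete_topology Q) (box_topology (Field k) R k)) \<phi>"
    unfolding \<phi>_def by (rule continuous_map_pairedI)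
  moreover have "continuous_map (prod_topology (discrete_topology Q) (box_topology (Field k) R k))
      (box_topology (Field k) R k) \<psi>"
  proof (rule continuous_map_prod_discrete_left)
    fix q assume "q \<in> Q"
    then obtain f where f: "f \<in> X" "q = block f"
      unfolding Q_def by blast
    show "continuous_map (box_topology (Field k) R k) (box_topology (Field k) R k) (\<lambda>g. \<psi> (q, g))"
      unfolding continuous_map_box_iff
    proof (intro conjI ballI)
      show "(\<lambda>g. \<psi> (q, g)) \<in> (Field k \<rightarrow>\<^sub>E R) \<rightarrow> (Field k \<rightarrow>\<^sub>E R)"
        using \<psi>_in f by (simp add: X_def)
    next
      fix g x assume g: "g \<in> Field k \<rightarrow>\<^sub>E R" and x: "x \<in> Field k"
      \<comment> \<open>Up to the level the value is prescribed by the block, so it depends on no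
        coordinate of \<open>g\<close>.\<close>
      let ?A = "if x \<in> under k (lev f) then {} else {e' (lev f) x}"
      have "?A \<subseteq> Field k" "|?A| <o k"
        using e'(1)[OF lev(1)[OF f(1)]] x by (auto intro: small_finite)
      then show "\<exists>A\<subseteq>Field k. |A| <o k \<and> (\<forall>h\<in>Field k \<rightarrow>\<^sub>E R. (\<forall>d\<in>A. h d = g d) \<longrightarrow> \<psi> (q, h) x = \<psi> (q, g) x)"
        unfolding f(2) \<psi>_block using x by (intro exI[of _ ?A]) simp
    qed
  qed
  moreover have "\<psi> (\<phi> f) = f" if "f \<in> X" for f
    using that e'[OF lev(1)[OF that]]
    by (auto simp: \<phi>_def \<psi>_block X_def fun_eq_iff PiE_iff extensional_def)
  moreover have "\<phi> (\<psi> (q, g)) = (q, g)" if q: "q \<in> Q" and g: "g \<in> X" for q g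
  proof -
    obtain f where f: "f \<in> X" "q = block f"
      using q unfolding Q_def by blast
    have agree: "\<forall>d\<in>under k (lev f). \<psi> (q, g) d = f d"
      using under_Field by (auto simp: f(2) \<psi>_block)
    have h: "\<psi> (q, g) \<in> X"
      using \<psi>_in f g by blast
    have "block (\<psi> (q, g)) = q"
      using block_cong[OF f(1) h agree] f(2) by simp
    moreover have "lev (\<psi> (q, g)) = lev f"
      using lev_cong[OF f(1) h agree] .
    moreover have "\<psi> (q, g) (e (lev f) x) = g x" if "x \<in> Field k" for x
      using e[OF lev(1)[OF f(1)] that] by (simp add: f(2) \<psi>_block)
    moreover have "g x = undefined" if "x \<notin> Field k" for x
      using g that by (auto simp: X_def)
    ultimately show ?thesis
      by (auto simp: \<phi>_def fun_eq_iff)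
  qed
  ultimately have "homeomorphic_maps (box_topology (Field k) R k)
      (prod_topology (discrete_topology Q) (box_topology (Field k) R k)) \<phi> \<psi>"
    unfolding homeomorphic_maps_def by (simp add: X_def)
  then show thesis
    using that \<open>k \<le>o |Q|\<close> unfolding homeomorphic_space_def by blast
qed

text \<open>The factor \<open>Q\<close> has some size at least \<open>k\<close>, so \<open>Q\<close>
  and \<open>Field k \<times> Q\<close> are equinumerous and \<open>Q\<close> can be traded for
  \<open>Field k\<close>.\<close>

lemma not_less_compact_box_absorbs_discrete:
  fixes R :: "'r set"
  assumes "\<not> less_compact (box_topology (Field k) R k) k"
  shows "box_topology (Field k) R k homeomorphic_space
    prod_topology (discrete_topology (Field k)) (box_topology (Field k) R k)"
proof -
  obtain Q :: "('k \<times> ('k \<Rightarrow> 'r)) set" where Q: "k \<le>o |Q|" "box_topology (Field k) R k homeomorphic_space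
       prod_topology (discrete_topology Q) (box_topology (Field k) R k)"
    using not_less_compact_box_discrete_factor[OF assms] .
  have le: "|Field k| \<le>o |Q|"
    using Q(1) card_of_Field ordIso_ordLeq_trans by blast
  then have "infinite Q"
    using infinite_Field card_of_ordLeq_finite by blast
  then have "|Q| =o |Field k \<times> Q|"
    using card_of_Times_infinite_simps(4)[OF _ _ le] infinite_Field by fastforce
  then obtain e where "bij_betw e Q (Field k \<times> Q)"
    using card_of_ordIso by blast
  with Q(2) show ?thesis
    by (rule discrete_factor_absorb)
qed

text \<open>Read a point over \<open>M \<times> Field k\<close> as an \<open>M\<close>-indexed
  family of rows. Applying the given homeomorphism to each row yields a family of labels in
  \<open>K\<close> and a new array over \<open>M \<times> Field k\<close>; the bijection
  \<open>e\<close> flattens this array to a family over \<open>M\<close>, which is paired with the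
  labels. The composite is written out explicitly so that continuity can be checked
  coordinatewise.\<close>

lemma box_power_absorbs_discrete:
  fixes M :: "'m set" and K :: "'i set" and R :: "'r set"
  assumes absorb: "box_topology (Field k) R k homeomorphic_space
      prod_topology (discrete_topology K) (box_topology (Field k) R k)"
    and bij: "bij_betw e M (M \<times> Field k)"
  shows "box_topology (M \<times> Field k) R k homeomorphic_space box_topology M (K \<times> R) k"
proof -
  define X where "X = (Field k \<rightarrow>\<^sub>E R)"
  obtain h h' where hom: "homeomorphic_maps (box_topology (Field k) R k)
      (prod_topology (discrete_topology K) (box_topology (Field k) R k)) h h'"
    using absorb unfolding homeomorphic_space_def by blast
  have "continuous_map (box_topology (Field k) R k) (discrete_topology K) (fst \<circ> h)"
    "continuous_map (box_topology (Field k) R k) (box_topology (Field k) R k) (snd \<circ> h)"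
    using hom continuous_map_fst_of continuous_map_snd_of unfolding homeomorphic_maps_def by blast+
  note h1 = this(1)[unfolded continuous_map_box_discrete_iff o_def, folded X_def]
    and h2 = this(2)[unfolded continuous_map_box_iff o_def, folded X_def]
  have "continuous_map (box_topology (Field k) R k) (box_topology (Field k) R k) (h' \<circ> (\<lambda>g. (i, g)))" if "i \<in> K" for i
    using hom that unfolding homeomorphic_maps_def
    by (intro continuous_map_compose[where X' = "prod_topology (discrete_topology K) (box_topology (Field k) R k)"])
      (auto intro: continuous_map_pairedI)
  note h'1 = this[unfolded continuous_map_box_iff o_def, folded X_def]
  have h_in: "fst (h f) \<in> K" "snd (h f) \<in> X" if "f \<in> X" for f
    using h1 h2 that by auto
  have h'_in: "h' (i, g) \<in> X" if "i \<in> K" "g \<in> X" for i g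
    using h'1 that by auto
  have h'h: "h' (h f) = f" if "f \<in> X" for f
    using hom that by (auto simp: homeomorphic_maps_def X_def)
  have hh': "h (h' (i, g)) = (i, g)" if "i \<in> K" "g \<in> X" for i g
    using hom that by (auto simp: homeomorphic_maps_def X_def)
  define e' where "e' = the_inv_into M e"
  have e: "fst (e x) \<in> M" "snd (e x) \<in> Field k" "e' (e x) = x" if "x \<in> M" for x
    using bij_betwE[OF bij, rule_format, OF that] bij that
    by (auto simp: e'_def bij_betw_def the_inv_into_f_f mem_Times_iff)
  have e': "e' (x, b) \<in> M" "e (e' (x, b)) = (x, b)" if "x \<in> M" "b \<in> Field k" for x b
    using bij that the_inv_into_into[of e M "(x, b)" M] f_the_inv_into_f[of e M "(x, b)"]
    by (auto simp: e'_def bij_betw_def)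
  define row where "row f x = (\<lambda>a\<in>Field k. f (x, a))" for f :: "'m \<times> 'k \<Rightarrow> 'r" and x
  \<comment> \<open>Recovers the transformed row \<open>x\<close> from its flattened entries, which
    are stored at the positions \<open>e' (x, b)\<close>.\<close>
  define col where "col p x = (\<lambda>b\<in>Field k. snd (p (e' (x, b))))" for p :: "'m \<Rightarrow> 'i \<times> 'r" and x
  define F where "F f = (\<lambda>x\<in>M. (fst (h (row f x)), snd (h (row f (fst (e x)))) (snd (e x))))" for f
  define G where "G p = (\<lambda>y\<in>M \<times> Field k. h' (fst (p (fst y)), col p (fst y)) (snd y))" for p
  have row_in: "row f x \<in> X" if "f \<in> M \<times> Field k \<rightarrow>\<^sub>E R" "x \<in> M" for f x
    using that by (auto simp: row_def X_def)
  have col_in: "col p x \<in> X" if "p \<in> M \<rightarrow>\<^sub>E K \<times> R" "x \<in> M" for p x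
  proof -
    have "p (e' (x, b)) \<in> K \<times> R" if "b \<in> Field k" for b
      using e'(1)[OF \<open>x \<in> M\<close> that] \<open>p \<in> _\<close> by blast
    then show ?thesis
      by (fastforce simp: col_def X_def)
  qed
  have p_in: "fst (p x) \<in> K" "snd (p x) \<in> R" if "p \<in> M \<rightarrow>\<^sub>E K \<times> R" "x \<in> M" for p :: "'m \<Rightarrow> 'i \<times> 'r" and x
    using PiE_mem[OF that] by auto
  have "continuous_map (box_topology (M \<times> Field k) R k) (box_topology M (K \<times> R) k) F"
    unfolding continuous_map_box_iff
  proof (intro conjI ballI)
    have "snd (h (row f (fst (e x)))) (snd (e x)) \<in> R" if "f \<in> M \<times> Field k \<rightarrow>\<^sub>E R" "x \<in> M" for f x
      using h_in(2)[OF row_in[OF that(1) e(1)[OF that(2)]]] e(2)[OF that(2)] by (auto simp: X_def)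
    then show "F \<in> (M \<times> Field k \<rightarrow>\<^sub>E R) \<rightarrow> (M \<rightarrow>\<^sub>E K \<times> R)"
      using h_in(1)[OF row_in] by (auto simp: F_def)
  next
    fix f x assume f: "f \<in> M \<times> Field k \<rightarrow>\<^sub>E R" and x: "x \<in> M"
    let ?y = "fst (e x)" and ?b = "snd (e x)"
    obtain A where A: "A \<subseteq> Field k" "|A| <o k"
      "\<forall>g\<in>X. (\<forall>d\<in>A. g d = row f x d) \<longrightarrow> fst (h g) = fst (h (row f x))"
      using bspec[OF conjunct2[OF h1] row_in[OF f x]] by (elim exE conjE)
    obtain B where B: "B \<subseteq> Field k" "|B| <o k"
      "\<forall>g\<in>X. (\<forall>d\<in>B. g d = row f ?y d) \<longrightarrow> snd (h g) ?b = snd (h (row f ?y)) ?b"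
      using bspec[OF bspec[OF conjunct2[OF h2] row_in[OF f e(1)[OF x]]] e(2)[OF x]] by (elim exE conjE)
    \<comment> \<open>Two rows matter: row \<open>x\<close> for the label, and row
      \<open>fst (e x)\<close> for the array entry stored at position \<open>x\<close>. Each
      contributes a small support.\<close>
    let ?C = "Pair x ` A \<union> Pair ?y ` B"
    have "F g x = F f x" if g: "g \<in> M \<times> Field k \<rightarrow>\<^sub>E R" and eq: "\<forall>d\<in>?C. g d = f d" for g
    proof -
      have "\<forall>d\<in>A. row g x d = row f x d" "\<forall>d\<in>B. row g ?y d = row f ?y d"
        using eq A(1) B(1) by (auto simp: row_def)
      then have "fst (h (row g x)) = fst (h (row f x))" "snd (h (row g ?y)) ?b = snd (h (row f ?y)) ?b"
        using A(3) B(3) row_in[OF g] x e(1) by blast+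
      then show ?thesis
        using x by (simp add: F_def)
    qed
    moreover have "?C \<subseteq> M \<times> Field k" "|?C| <o k"
      using A(1,2) B(1,2) x e(1) by (auto intro: small_Un small_image)
    ultimately show "\<exists>C\<subseteq>M \<times> Field k. |C| <o k \<and>
        (\<forall>g\<in>M \<times> Field k \<rightarrow>\<^sub>E R. (\<forall>d\<in>C. g d = f d) \<longrightarrow> F g x = F f x)"
      by blast
  qed
  moreover have "continuous_map (box_topology M (K \<times> R) k) (box_topology (M \<times> Field k) R k) G"
    unfolding continuous_map_box_iff
  proof (intro conjI ballI)
    have "h' (fst (p x), col p x) a \<in> R" if "p \<in> M \<rightarrow>\<^sub>E K \<times> R" "x \<in> M" "a \<in> Field k" for p x a
      using h'_in[OF p_in(1)[OF that(1,2)] col_in[OF that(1,2)]] that(3) by (auto simp: X_def)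
    then show "G \<in> (M \<rightarrow>\<^sub>E K \<times> R) \<rightarrow> (M \<times> Field k \<rightarrow>\<^sub>E R)"
      unfolding G_def by (intro funcsetI restrict_PiE_iff[THEN iffD2]) auto
  next
    fix p y assume p: "p \<in> M \<rightarrow>\<^sub>E K \<times> R" and "y \<in> M \<times> Field k"
    then obtain x a where y: "y = (x, a)" "x \<in> M" "a \<in> Field k"
      by blast
    obtain A where A: "A \<subseteq> Field k" "|A| <o k"
      "\<forall>g\<in>X. (\<forall>d\<in>A. g d = col p x d) \<longrightarrow> h' (fst (p x), g) a = h' (fst (p x), col p x) a"
      using bspec[OF bspec[OF conjunct2[OF h'1[OF p_in(1)[OF p y(2)]]] col_in[OF p y(2)]] y(3)]
      by (elim exE conjE)
    \<comment> \<open>Position \<open>x\<close> supplies the label of the row; the other positions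
      hold those entries of the transformed row on which the value at \<open>a\<close>
      depends.\<close>
    let ?C = "insert x ((\<lambda>b. e' (x, b)) ` A)"
    have "G q y = G p y" if q: "q \<in> M \<rightarrow>\<^sub>E K \<times> R" and eq: "\<forall>d\<in>?C. q d = p d" for q
    proof -
      have "\<forall>d\<in>A. col q x d = col p x d"
        using eq A(1) by (auto simp: col_def)
      then have "h' (fst (p x), col q x) a = h' (fst (p x), col p x) a"
        using A(3) col_in[OF q y(2)] by blast
      then show ?thesis
        using y eq by (simp add: G_def)
    qed
    moreover have "?C \<subseteq> M" "|?C| <o k"
      using A(1,2) y(2) e'(1) by (auto intro: small_insert small_image)
    ultimately show "\<exists>C\<subseteq>M. |C| <o k \<and> (\<forall>q\<in>M \<rightarrow>\<^sub>E K \<times> R. (\<forall>d\<in>C. q d = p d) \<longrightarrow> G q y = G p y)"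
      by blast
  qed
  moreover have "G (F f) = f" if f: "f \<in> M \<times> Field k \<rightarrow>\<^sub>E R" for f
  proof
    fix y show "G (F f) y = f y"
    proof (cases "y \<in> M \<times> Field k")
      case True
      then obtain x a where y: "y = (x, a)" "x \<in> M" "a \<in> Field k"
        by blast
      have "col (F f) x b = snd (h (row f x)) b" for b
        using h_in(2)[OF row_in[OF f y(2)]] e'[OF y(2), of b] by (auto simp: col_def F_def X_def)
      then have "(fst (F f x), col (F f) x) = h (row f x)"
        using y(2) by (auto simp: F_def prod_eq_iff)
      then show ?thesis
        using y h'h[OF row_in[OF f y(2)]] by (simp add: G_def row_def)
    next
      case False
      then show ?thesis
        using PiE_arb[OF f] by (auto simp: G_def)
    qed
  qed
  moreover have "F (G p) = p" if p: "p \<in> M \<rightarrow>\<^sub>E K \<times> R" for p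
  proof
    have row: "row (G p) x = h' (fst (p x), col p x)" if "x \<in> M" for x
      using PiE_arb[OF h'_in[OF p_in(1)[OF p that] col_in[OF p that], unfolded X_def]] that
      by (auto simp: row_def G_def fun_eq_iff)
    fix x show "F (G p) x = p x"
    proof (cases "x \<in> M")
      case True
      have "col p (fst (e x)) (snd (e x)) = snd (p x)"
        using e[OF True] by (simp add: col_def)
      then show ?thesis
        using True e(1)[OF True] hh'[OF p_in(1)[OF p] col_in[OF p]]
        by (simp add: F_def row)
    next
      case False
      then show ?thesis
        using PiE_arb[OF p] by (auto simp: F_def)
    qed
  qed
  ultimately have "homeomorphic_maps (box_topology (M \<times> Field k) R k) (box_topology M (K \<times> R) k) F G"
    unfolding homeomorphic_maps_def by simp
  then show ?thesis
    unfolding homeomorphic_space_def by blast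
qed

section \<open>The compact case: few values and few coordinates\<close>

lemma less_compact_discrete_image:
  assumes compact: "less_compact X k"
    and cont: "continuous_map X (discrete_topology I) c"
  shows "|c ` topspace X| <o k"
proof -
  \<comment> \<open>The fibres are open and pairwise disjoint, so a subcover has to keep every
    nonempty one; a small subcover therefore bounds the number of values.\<close>
  define W where "W i = {p \<in> topspace X. c p \<in> {i}}" for i
  have "openin X (W i)" if "i \<in> c ` topspace X" for i
  proof -
    have "openin (discrete_topology I) {i}"
      using cont that by (auto simp: continuous_map_def)
    then show ?thesis
      unfolding W_def by (rule openin_continuous_map_preimage[OF cont])
  qed
  then have "\<forall>u\<in>W ` c ` topspace X. openin X u"
    by blast
  moreover have "topspace X \<subseteq> \<Union>(W ` c ` topspace X)"
    by (auto simp: W_def)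
  ultimately obtain V where V: "V \<subseteq> W ` c ` topspace X" "|V| <o k" "topspace X \<subseteq> \<Union>V"
    using compact unfolding less_compact_def by meson
  \<comment> \<open>A fibre determines its value through any of its points, here the one chosen by
    \<open>SOME\<close>.\<close>
  have "c ` topspace X \<subseteq> (\<lambda>w. c (SOME p. p \<in> w)) ` V"
  proof
    fix i assume "i \<in> c ` topspace X"
    then obtain p w where p: "c p = i" "w \<in> V" "p \<in> w"
      using V(3) by blast
    moreover obtain j where "w = W j"
      using V(1) p(2) by blast
    ultimately have "w = W i"
      by (simp add: W_def)
    then have "c (SOME p. p \<in> w) = i"
      using someI[of "\<lambda>p. p \<in> w", OF p(3)] by (simp add: W_def)
    then show "i \<in> (\<lambda>w. c (SOME p. p \<in> w)) ` V"
      using p(2) by (metis imageI)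
  qed
  then show ?thesis
    using small_subset small_image[OF V(2)] by blast
qed

text \<open>Place a copy of \<open>B\<close> inside \<open>k\<close>. Restriction to this copy is
  locally constant because its support is small, and it attains every assignment on
  \<open>B\<close>; compactness bounds the number of its values.\<close>

lemma less_compact_box_imp_strong_limit:
  assumes compact: "less_compact (box_topology (Field k) (UNIV :: 'r set) k) k"
    and small: "|B| <o k"
  shows "|B \<rightarrow>\<^sub>E (UNIV :: 'r set)| <o k"
proof -
  have "|B| \<le>o |Field k|"
    using small card_of_Field ordLess_ordIso_trans ordIso_symmetric ordLess_imp_ordLeq by blast
  then obtain \<iota> where \<iota>: "inj_on \<iota> B" "\<iota> ` B \<subseteq> Field k"
    using card_of_ordLeq[of B "Field k"] by blast
  define c where "c p = (\<lambda>x\<in>B. p (\<iota> x))" for p :: "'k \<Rightarrow> 'r"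
  have "continuous_map (box_topology (Field k) UNIV k) (discrete_topology (B \<rightarrow>\<^sub>E UNIV)) c"
    unfolding continuous_map_box_discrete_iff
  proof (intro conjI ballI)
    fix f :: "'k \<Rightarrow> 'r"
    have "c g = c f" if "\<forall>d\<in>\<iota> ` B. g d = f d" for g
      using that by (auto simp: c_def fun_eq_iff)
    then show "\<exists>A\<subseteq>Field k. |A| <o k \<and> (\<forall>g\<in>Field k \<rightarrow>\<^sub>E UNIV. (\<forall>d\<in>A. g d = f d) \<longrightarrow> c g = c f)"
      using \<iota>(2) small_image[OF small] by blast
  qed (auto simp: c_def)
  then have "|c ` (Field k \<rightarrow>\<^sub>E UNIV)| <o k"
    using less_compact_discrete_image[OF compact] by simp
  moreover have "(B \<rightarrow>\<^sub>E UNIV) \<subseteq> c ` (Field k \<rightarrow>\<^sub>E UNIV)"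
  proof
    fix s :: "'a \<Rightarrow> 'r" assume s: "s \<in> B \<rightarrow>\<^sub>E UNIV"
    have "\<iota> x \<in> Field k" if "x \<in> B" for x
      using \<iota>(2) that by blast
    then have "c (\<lambda>y\<in>Field k. s (the_inv_into B \<iota> y)) x = s x" for x
      using \<iota>(1) PiE_arb[OF s] by (cases "x \<in> B") (simp_all add: c_def the_inv_into_f_f)
    then have "c (\<lambda>y\<in>Field k. s (the_inv_into B \<iota> y)) = s"
      by (rule ext)
    then show "s \<in> c ` (Field k \<rightarrow>\<^sub>E UNIV)"
      by (metis imageI restrict_PiE_iff UNIV_I)
  qed
  ultimately show ?thesis
    using small_subset by blast
qed

text \<open>A chain of \<open>k\<close> small stages is built with union \<open>T\<close>. By
  regularity, the part in \<open>T\<close> of a small support lies in a single stage, and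
  \<open>c\<close> does not change when \<open>f\<close> is cut down to that stage. Functions that
  agree on \<open>T\<close> have the same cut, hence the same value.\<close>

lemma locally_constant_determined_by_few_coordinates:
  fixes M :: "'m set" and c :: "('m \<Rightarrow> 'r) \<Rightarrow> 'i"
  assumes limit: "\<And>B :: 'm set. |B| <o k \<Longrightarrow> |B \<rightarrow>\<^sub>E (UNIV :: 'r set)| <o k"
    and cont: "continuous_map (box_topology M UNIV k) (discrete_topology I) c"
  obtains S where "S \<subseteq> M" "|S| \<le>o k"
    "\<forall>f\<in>M \<rightarrow>\<^sub>E UNIV. \<forall>g\<in>M \<rightarrow>\<^sub>E UNIV. (\<forall>x\<in>S. f x = g x) \<longrightarrow> c f = c g"
proof -
  obtain A where A: "\<And>f. f \<in> M \<rightarrow>\<^sub>E UNIV \<Longrightarrow> A f \<subseteq> M" "\<And>f. f \<in> M \<rightarrow>\<^sub>E UNIV \<Longrightarrow> |A f| <o k"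
    "\<And>f g. f \<in> M \<rightarrow>\<^sub>E UNIV \<Longrightarrow> g \<in> M \<rightarrow>\<^sub>E UNIV \<Longrightarrow> (\<forall>d\<in>A f. g d = f d) \<Longrightarrow> c g = c f"
    using conjunct2[OF cont[unfolded continuous_map_box_discrete_iff]] by metis
  \<comment> \<open>Closing off: if \<open>B\<close> is small, then so is \<open>N B\<close>, by the strong limit property and regularity;
      \<open>N B\<close> contains, for every assignment on \<open>B\<close>, coordinates deciding \<open>c\<close> on an extension of it
      (namely the one that is \<open>undefined\<close> off \<open>B\<close>).\<close>
  define N where "N B = B \<union> (\<Union>s\<in>B \<rightarrow>\<^sub>E UNIV. A s)" for B
  define H where "H F a = (\<Union>b\<in>underS k a. N (F b))" for F and a :: 'k
  define S where "S = wo_rel.worec k H"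
  have "wo_rel.adm_wo k H"
    unfolding wo_rel.adm_wo_def[OF wo_rel] H_def by auto
  then have S: "S a = (\<Union>b\<in>underS k a. N (S b))" for a
    unfolding S_def using wo_rel.worec_fixpoint[OF wo_rel] H_def by metis
  \<comment> \<open>An assignment on \<open>B\<close> is \<open>undefined\<close> off
    \<open>B\<close>, so it is itself a point of the larger function space and \<open>A\<close> can
    be applied to it directly.\<close>
  have sub: "B \<rightarrow>\<^sub>E UNIV \<subseteq> M \<rightarrow>\<^sub>E UNIV" if "B \<subseteq> M" for B
    using that by (auto simp: PiE_iff extensional_def)
  have N: "N B \<subseteq> M" "|N B| <o k" if "B \<subseteq> M" "|B| <o k" for B
  proof -
    have "s \<in> M \<rightarrow>\<^sub>E UNIV" if "s \<in> B \<rightarrow>\<^sub>E UNIV" for s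
      using sub[OF \<open>B \<subseteq> M\<close>] that by blast
    note A' = A(1,2)[OF this]
    show "N B \<subseteq> M"
      unfolding N_def using \<open>B \<subseteq> M\<close> A'(1) by (intro Un_least UN_least)
    show "|N B| <o k"
      unfolding N_def using \<open>|B| <o k\<close> A'(2) limit by (intro small_Un small_UN)
  qed
  have S_small: "S a \<subseteq> M \<and> |S a| <o k" for a
  proof (induction a rule: wo_rel.well_order_induct[OF wo_rel])
    case (1 a)
    have "|underS k a| <o k"
    \<comment> \<open>The recursion ranges over the whole type; a point outside the field has no
      predecessors and gets the empty stage.\<close>
    proof (cases "a \<in> Field k")
      case True
      then show ?thesis
        by (rule card_of_underS[OF card_order])
    next
      case False
      then have "underS k a = {}"
        by (auto simp: underS_def Field_def)
      then show ?thesis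
        by (simp add: small_finite)
    qed
    moreover have "N (S b) \<subseteq> M" "|N (S b)| <o k" if "b \<in> underS k a" for b
    proof -
      have "S b \<subseteq> M \<and> |S b| <o k"
        using 1[rule_format, of b] that by (simp add: underS_def)
      then show "N (S b) \<subseteq> M" "|N (S b)| <o k"
        using N by blast+
    qed
    ultimately show ?case
      unfolding S[of a] by (intro conjI UN_least small_UN)
  qed
  have S_mono: "S b \<subseteq> S a" if "(b, a) \<in> k" for a b
  proof -
    have "underS k b \<subseteq> underS k a"
      using that wo_rel.TRANS[OF wo_rel] wo_rel.ANTISYM[OF wo_rel]
      unfolding underS_def trans_def antisym_def by blast
    then show ?thesis
      unfolding S[of a] S[of b] by blast
  qed
  define T where "T = (\<Union>a\<in>Field k. S a)"
  \<comment> \<open>An infinite cardinal has no last element, so the closure of each stage is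
    contained in a later stage.\<close>
  have NS_T: "N (S a) \<subseteq> T" if a: "a \<in> Field k" for a
  proof -
    obtain b where "b \<in> Field k" "a \<in> underS k b"
      using infinite_Card_order_limit[OF card_order infinite_Field a] by (auto simp: underS_def)
    then show ?thesis
      unfolding T_def using S[of b] by blast
  qed
  \<comment> \<open>Each point of \<open>B\<close> enters at some stage; by regularity these fewer
    than \<open>k\<close> stages have an upper bound, and the chain is increasing.\<close>
  have bounded: "\<exists>a\<in>Field k. B \<subseteq> S a" if B: "B \<subseteq> T" "|B| <o k" for B
  proof -
    obtain l where l: "\<And>x. x \<in> B \<Longrightarrow> l x \<in> Field k \<and> x \<in> S (l x)"
      using B(1) unfolding T_def by (metis UN_iff subset_iff)
    have "l ` B \<subseteq> Field k"
      using l by blast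
    then obtain a where a: "a \<in> Field k" "l ` B \<subseteq> under k a"
      using small_bounded small_image[OF B(2)] by blast
    have "x \<in> S a" if "x \<in> B" for x
      using S_mono[of "l x" a] l[OF that] a(2) that by (auto simp: under_def)
    then show ?thesis
      using a(1) by blast
  qed
  have c_restrict: "c f = c (restrict f (S a))"
    if f: "f \<in> M \<rightarrow>\<^sub>E UNIV" and a: "a \<in> Field k" "A f \<inter> T \<subseteq> S a" for f a
  proof -
    define t where "t = restrict f (S a)"
    have t: "t \<in> S a \<rightarrow>\<^sub>E UNIV"
      by (simp add: t_def)
    then have tM: "t \<in> M \<rightarrow>\<^sub>E UNIV"
      using sub[OF conjunct1[OF S_small]] by blast
    have At: "A t \<subseteq> T"
      using NS_T[OF a(1)] t unfolding N_def by blast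
    \<comment> \<open>A common extension of \<open>f\<close> on \<open>A f\<close> and \<open>t\<close> on \<open>A t\<close>; these agree where both apply,
        since \<open>A t\<close> lies in \<open>T\<close>.\<close>
    define h where "h x = (if x \<in> A t then t x else f x)" for x
    have "h \<in> M \<rightarrow>\<^sub>E UNIV"
      using f tM by (auto simp: h_def PiE_iff extensional_def)
    moreover have "\<forall>d\<in>A t. h d = t d"
      by (simp add: h_def)
    moreover have "\<forall>d\<in>A f. h d = f d"
      using At a(2) by (auto simp: h_def t_def)
    ultimately show ?thesis
      using A(3)[OF f, of h] A(3)[OF tM, of h] by (simp add: t_def)
  qed
  have "c f = c g" if f: "f \<in> M \<rightarrow>\<^sub>E UNIV" and g: "g \<in> M \<rightarrow>\<^sub>E UNIV"
    and eq: "\<forall>x\<in>T. f x = g x" for f g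
  proof -
    have "|(A f \<union> A g) \<inter> T| <o k"
      by (rule small_subset[OF _ small_Un[OF A(2)[OF f] A(2)[OF g]]]) blast
    then obtain a where a: "a \<in> Field k" "(A f \<union> A g) \<inter> T \<subseteq> S a"
      using bounded[of "(A f \<union> A g) \<inter> T"] by blast
    have "S a \<subseteq> T"
      unfolding T_def using a(1) by blast
    then have "restrict f (S a) = restrict g (S a)"
      using eq by (intro restrict_ext) blast
    moreover have "A f \<inter> T \<subseteq> S a" "A g \<inter> T \<subseteq> S a"
      using a(2) by blast+
    ultimately show ?thesis
      using c_restrict[OF f a(1)] c_restrict[OF g a(1)] by simp
  qed
  moreover have "T \<subseteq> M"
    unfolding T_def using S_small by blast
  moreover have "|T| \<le>o k"
    unfolding T_def
    by (rule card_of_UNION_ordLeq_infinite_Field[OF infinite_Field card_order])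
      (use card_of_Field ordIso_iff_ordLeq S_small ordLess_imp_ordLeq in blast)+
  ultimately show thesis
    using that by blast
qed

text \<open>Under a homeomorphism, a coordinate of the second space would become a locally constant
  map on the first with \<open>k\<close> values. It depends on at most \<open>k\<close> coordinates,
  so it can be pulled back to the space over \<open>Field k\<close> without losing a value, and
  there compactness allows fewer than \<open>k\<close> values.\<close>

lemma less_compact_box_not_homeomorphic:
  fixes M :: "'m set"
  assumes compact: "less_compact (box_topology (Field k) (UNIV :: 'r set) k) k"
    and "M \<noteq> {}"
  shows "\<not> box_topology M (UNIV :: 'r set) k homeomorphic_space box_topology M (Field k) k"
proof
  assume "box_topology M (UNIV :: 'r set) k homeomorphic_space box_topology M (Field k) k"
  then obtain \<Phi> \<Psi> where hom: "homeomorphic_maps (box_topology M (UNIV :: 'r set) k) (box_topology M (Field k) k) \<Phi> \<Psi>"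
    unfolding homeomorphic_space_def by blast
  obtain x0 where x0: "x0 \<in> M"
    using \<open>M \<noteq> {}\<close> by blast
  define c where "c = (\<lambda>h. h x0) \<circ> \<Phi>"
  have "continuous_map (box_topology M (Field k) k) (discrete_topology (Field k)) (\<lambda>h. h x0)"
    unfolding continuous_map_box_discrete_iff
    using x0 small_finite[of "{x0}"] by (auto intro!: exI[of _ "{x0}"])
  then have c: "continuous_map (box_topology M UNIV k) (discrete_topology (Field k)) c"
    unfolding c_def using hom continuous_map_compose unfolding homeomorphic_maps_def by blast
  have c_surj: "\<exists>f\<in>M \<rightarrow>\<^sub>E UNIV. c f = i" if "i \<in> Field k" for i
  proof -
    \<comment> \<open>Constant functions show that the coordinate at \<open>x0\<close> takes every
      value in \<open>Field k\<close>.\<close>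
    define g where "g = (\<lambda>x\<in>M. i)"
    have g: "g \<in> topspace (box_topology M (Field k) k)"
      using that by (simp add: g_def)
    have "\<Phi> (\<Psi> g) = g" "\<Psi> g \<in> topspace (box_topology M UNIV k)"
      using hom g unfolding homeomorphic_maps_def continuous_map_def by blast+
    then show ?thesis
      using x0 by (intro bexI[of _ "\<Psi> g"]) (auto simp: c_def g_def)
  qed
  have limit: "|B \<rightarrow>\<^sub>E (UNIV :: 'r set)| <o k" if "|B| <o k" for B :: "'m set"
    using less_compact_box_imp_strong_limit[OF compact that] .
  obtain S where S: "S \<subseteq> M" "|S| \<le>o k"
    and det: "\<forall>f\<in>M \<rightarrow>\<^sub>E UNIV. \<forall>g\<in>M \<rightarrow>\<^sub>E UNIV. (\<forall>x\<in>S. f x = g x) \<longrightarrow> c f = c g"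
    using locally_constant_determined_by_few_coordinates[OF limit c] .
  have "|S| \<le>o |Field k|"
    using S(2) card_of_Field ordLeq_ordIso_trans ordIso_symmetric by blast
  then obtain \<iota> where \<iota>: "inj_on \<iota> S" "\<iota> ` S \<subseteq> Field k"
    using card_of_ordLeq[of S "Field k"] by blast
  define pull where "pull p = (\<lambda>x\<in>S. p (\<iota> x))" for p :: "'k \<Rightarrow> 'r"
  have pull: "pull p \<in> M \<rightarrow>\<^sub>E UNIV" for p
    using S(1) by (auto simp: pull_def PiE_iff extensional_def)
  have "continuous_map (box_topology (Field k) UNIV k) (box_topology M UNIV k) pull"
    unfolding continuous_map_box_iff
  proof (intro conjI ballI)
    fix f :: "'k \<Rightarrow> 'r" and x
    show "\<exists>A\<subseteq>Field k. |A| <o k \<and> (\<forall>g\<in>Field k \<rightarrow>\<^sub>E UNIV. (\<forall>d\<in>A. g d = f d) \<longrightarrow> pull g x = pull f x)"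
      using \<iota>(2) small_finite[of "\<iota> ` ({x} \<inter> S)"]
      by (intro exI[of _ "\<iota> ` ({x} \<inter> S)"]) (auto simp: pull_def)
  qed (use pull in auto)
  then have "continuous_map (box_topology (Field k) UNIV k) (discrete_topology (Field k)) (c \<circ> pull)"
    using c continuous_map_compose by blast
  then have "|(c \<circ> pull) ` (Field k \<rightarrow>\<^sub>E UNIV)| <o k"
    using less_compact_discrete_image[OF compact] unfolding topspace_box by blast
  moreover have "Field k \<subseteq> (c \<circ> pull) ` (Field k \<rightarrow>\<^sub>E UNIV)"
  proof
    fix i assume "i \<in> Field k"
    then obtain f where f: "f \<in> M \<rightarrow>\<^sub>E UNIV" "c f = i"
      using c_surj by blast
    \<comment> \<open>Carries the values of \<open>f\<close> on \<open>S\<close> over to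
      \<open>k\<close>. The pullback of \<open>p\<close> agrees with \<open>f\<close> on
      \<open>S\<close> but may differ elsewhere, where \<open>c\<close> does not look.\<close>
    define p where "p = (\<lambda>y\<in>Field k. f (the_inv_into S \<iota> y))"
    have "pull p x = f x" if "x \<in> S" for x
      using \<iota> that by (auto simp: pull_def p_def the_inv_into_f_f)
    then have "c (pull p) = i"
      using det[rule_format, OF pull f(1)] f(2) by simp
    then show "i \<in> (c \<circ> pull) ` (Field k \<rightarrow>\<^sub>E UNIV)"
      by (intro image_eqI[of _ _ p]) (auto simp: p_def)
  qed
  ultimately have "|Field k| <o k"
    using small_subset by blast
  then show False
    using card_of_Field not_ordLess_ordIso by blast
qed

end

section \<open>The equivalence for singular exponents\<close>

theorem mainTheorem4:
  fixes k :: "'k rel" and m :: "'m rel"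
  assumes "Card_order k" and "infinite (Field k)" and "regularCard k"
    and "Card_order m" and "singular_card m" and "cf_is m k"
  shows "box_topology (Field m) (UNIV :: bool set) k homeomorphic_space
           box_topology (Field m) (Field k) k
         \<longleftrightarrow> \<not> weakly_compact k"
proof -
  interpret regular_cardinal k
    using assms(1-3) by unfold_locales
  have wc: "weakly_compact k \<longleftrightarrow> less_compact (box_topology (Field k) (UNIV :: bool set) k) k"
    using assms(1,2) by (simp add: weakly_compact_def)
  have inf_m: "infinite (Field m)"
    using \<open>singular_card m\<close> by (simp add: singular_card_def)
  \<comment> \<open>A cofinal set of size \<open>k\<close> inside \<open>Field m\<close> gives
    \<open>k \<le> |Field m|\<close>, which makes \<open>Field m \<times> Field k\<close>
    equinumerous with \<open>Field m\<close>.\<close>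
  obtain K where "K \<subseteq> Field m" "|K| =o k"
    using \<open>cf_is m k\<close> unfolding cf_is_def by blast
  then have "k \<le>o |Field m|"
    using card_of_mono1 ordIso_symmetric ordIso_ordLeq_trans by blast
  then have le: "|Field k| \<le>o |Field m|"
    using card_of_Field ordIso_ordLeq_trans by blast
  show ?thesis
  proof
    assume "box_topology (Field m) (UNIV :: bool set) k homeomorphic_space box_topology (Field m) (Field k) k"
    then show "\<not> weakly_compact k"
      using less_compact_box_not_homeomorphic[where 'r = bool, of "Field m"] inf_m wc by fastforce
  next
    assume "\<not> weakly_compact k"
    then have "\<not> less_compact (box_topology (Field k) (UNIV :: bool set) k) k"
      unfolding wc .
    then have absorb: "box_topology (Field k) (UNIV :: bool set) k homeomorphic_space
        prod_topology (discrete_topology (Field k)) (box_topology (Field k) (UNIV :: bool set) k)"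
      by (rule not_less_compact_box_absorbs_discrete)
    have "|Field m| =o |Field m \<times> Field k|"
      using card_of_Times_infinite_simps(2)[OF inf_m _ le] assms(2) by fastforce
    then obtain e where e: "bij_betw e (Field m) (Field m \<times> Field k)"
      using card_of_ordIso by blast
    have "|UNIV :: bool set| \<le>o |Field k|"
      using ordLess_imp_ordLeq[OF small_finite[OF finite]] ordIso_symmetric[OF card_of_Field]
      by (rule ordLeq_ordIso_trans)
    then have "|Field k \<times> (UNIV :: bool set)| =o |Field k|"
      using card_of_Times_infinite_simps(1)[OF assms(2)] by blast
    then obtain e' :: "'k \<times> bool \<Rightarrow> 'k" where e': "bij_betw e' (Field k \<times> UNIV) (Field k)"
      using card_of_ordIso by blast
    \<comment> \<open>The chain rearranges \<open>m\<close> coordinates into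
      \<open>m \<times> k\<close>, turns each row into a label in \<open>k\<close> and a new row,
      and finally identifies \<open>k \<times> 2\<close> with \<open>k\<close>.\<close>
    have "box_topology (Field m) (UNIV :: bool set) k homeomorphic_space
        box_topology (Field m \<times> Field k) (UNIV :: bool set) k"
      by (rule homeomorphic_space_sym[THEN iffD1, OF box_reindex_domain[OF e]])
    also have "\<dots> homeomorphic_space box_topology (Field m) (Field k \<times> (UNIV :: bool set)) k"
      using absorb e by (rule box_power_absorbs_discrete)
    also have "\<dots> homeomorphic_space box_topology (Field m) (Field k) k"
      using e' by (rule box_reindex_range)
    finally show "box_topology (Field m) (UNIV :: bool set) k homeomorphic_space
        box_topology (Field m) (Field k) k" .
  qed
qed

end
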